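(* The area functional $F:\mathbb{R}^6\to\mathbb{R}$, defined over real $2\times3$ matrices $x=(x_j^i)_{1\le i\le 2,\,1\le j\le 3}$ by $$F(x)=\left[(x_1^1x_2^2-x_1^2x_2^1)^2+(x_1^1x_3^2-x_1^2x_3^1)^2+(x_2^1x_3^2-x_2^2x_3^1)^2\right]^{1/2},$$ is its own Legendre transform (in other words, it is self-dual): $F^L=F$, that is, $$F^L(y)=\left[(y_1^2y_2^3-y_2^2y_1^3)^2+(y_1^1y_2^3-y_2^1y_1^3)^2+(y_1^1y_2^2-y_2^1y_1^2)^2\right]^{1/2},$$ where $y=(y_i^j)_{1\le i\le 2,\,1\le j\le 3}$.
   Context: The pairing is $\langle x,y\rangle=\sum_{i,j}x_j^i y_i^j$, and $F'(x)$ is the matrix with entries $y_i^j=\partial F/\partial x_j^i$. Definition (Legendre transform). Let $X$ be a finite-dimensional real vector space with dual $Y$ and duality pairing $\langle x,y\rangle$. Consider a map $F:\Omega\to\mathbb{R}$, where $\Omega$ is a submanifold of $X$, and set $\Sigma=F'(\Omega)$, where $F'(x)\in Y$ denotes the derivative of $F$ at $x$. A $C^1$ function $G:\Sigma\to\mathbb{R}$ is the Legendre transform of $F$, denoted $F^L$, if $\Sigma$ is a submanifold of $Y$ and $$[x\in\Omega,\ y=F'(x)]\ \Longrightarrow\ \langle x,y\rangle-F(x)=G(y).$$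
   Formalization: F is not differentiable at nonzero matrices of rank 1, so the Legendre transform is taken over the rank-2 matrices (the largest open set where F is C^1); F^L on all of R^6 is its unique continuous extension, and F^L = F is read up to transposition. *)

theory Defs
  imports "HOL-Analysis.Analysis"
begin

text \<open>
  Differentiability class \<open>C\<^sup>k\<close> on an open set \<open>U\<close>. In finite dimension, continuity of all
  directional derivatives of order up to \<open>k\<close> is the same as continuity of the Frechet derivatives;
  directional derivatives keep the type of the function unchanged along the recursion.
\<close>
primrec Ck_on :: "nat \<Rightarrow> ('a::euclidean_space \<Rightarrow> 'b::euclidean_space) \<Rightarrow> 'a set \<Rightarrow> bool" where
  "Ck_on 0 f U \<longleftrightarrow> continuous_on U f"
| "Ck_on (Suc k) f U \<longleftrightarrow>
     (\<forall>x\<in>U. f differentiable (at x)) \<and>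
     (\<forall>v. Ck_on k (\<lambda>x. frechet_derivative f (at x) v) U)"

definition smooth_diffeo ::
  "'a::euclidean_space set \<Rightarrow> 'a set \<Rightarrow> ('a \<Rightarrow> 'a) \<Rightarrow> ('a \<Rightarrow> 'a) \<Rightarrow> bool" where
  "smooth_diffeo U V \<phi> \<psi> \<longleftrightarrow>
     open U \<and> open V \<and> homeomorphism U V \<phi> \<psi> \<and> (\<forall>k. Ck_on k \<phi> U \<and> Ck_on k \<psi> V)"

text \<open>
  Embedded smooth submanifolds, via slice charts: near each of its points the set is carried by a
  diffeomorphism of the ambient space onto an open piece of a linear subspace.
\<close>
definition submanifold :: "'a::euclidean_space set \<Rightarrow> bool" where
  "submanifold S \<longleftrightarrow>
     (\<exists>d. \<forall>p\<in>S. \<exists>U V \<phi> \<psi> L. p \<in> U \<and> smooth_diffeo U V \<phi> \<psi> \<and>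
        subspace L \<and> dim L = d \<and> \<phi> ` (U \<inter> S) = V \<inter> L)"

text \<open>A function on a submanifold is \<open>C\<^sup>1\<close> if it extends locally to a \<open>C\<^sup>1\<close> function on an open set.\<close>
definition C1_on_submanifold :: "'a::euclidean_space set \<Rightarrow> ('a \<Rightarrow> real) \<Rightarrow> bool" where
  "C1_on_submanifold S g \<longleftrightarrow>
     (\<forall>p\<in>S. \<exists>U h. open U \<and> p \<in> U \<and> Ck_on 1 h U \<and> (\<forall>x\<in>U \<inter> S. h x = g x))"

text \<open>
  A dual pair of finite-dimensional real vector spaces: a nondegenerate pairing identifies \<open>'b\<close>
  with the dual of \<open>'a\<close>. (The Euclidean structure of the two types plays no role.)
\<close>
definition duality_pairing :: "('a::euclidean_space \<Rightarrow> 'b::euclidean_space \<Rightarrow> real) \<Rightarrow> bool" where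
  "duality_pairing p \<longleftrightarrow> bilinear p \<and>
     (\<forall>x. (\<forall>y. p x y = 0) \<longrightarrow> x = 0) \<and> (\<forall>y. (\<forall>x. p x y = 0) \<longrightarrow> y = 0)"

text \<open>
  \<open>y = F'(x)\<close> for \<open>F : \<Omega> \<rightarrow> \<real>\<close>. Only the values of \<open>F\<close> on \<open>\<Omega>\<close> matter. For open \<open>\<Omega>\<close> this is the
  ordinary derivative, and \<open>y\<close> is unique; on a lower-dimensional \<open>\<Omega>\<close> every \<open>y\<close> that represents the
  derivative along \<open>\<Omega>\<close> is admitted, hence a relation.
\<close>
definition is_derivative_at ::
  "('a::euclidean_space \<Rightarrow> 'b::euclidean_space \<Rightarrow> real) \<Rightarrow> 'a set \<Rightarrow> ('a \<Rightarrow> real) \<Rightarrow> 'a \<Rightarrow> 'b \<Rightarrow> bool" where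
  "is_derivative_at p \<Omega> F x y \<longleftrightarrow> (F has_derivative (\<lambda>h. p h y)) (at x within \<Omega>)"

text \<open>The set \<open>\<Sigma> = F'(\<Omega>)\<close>.\<close>
definition derivative_image ::
  "('a::euclidean_space \<Rightarrow> 'b::euclidean_space \<Rightarrow> real) \<Rightarrow> 'a set \<Rightarrow> ('a \<Rightarrow> real) \<Rightarrow> 'b set" where
  "derivative_image p \<Omega> F = {y. \<exists>x\<in>\<Omega>. is_derivative_at p \<Omega> F x y}"

definition is_legendre_transform ::
  "('a::euclidean_space \<Rightarrow> 'b::euclidean_space \<Rightarrow> real) \<Rightarrow> 'a set \<Rightarrow> ('a \<Rightarrow> real) \<Rightarrow> ('b \<Rightarrow> real) \<Rightarrow> bool" where
  "is_legendre_transform p \<Omega> F G \<longleftrightarrow>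
     duality_pairing p \<and>
     submanifold \<Omega> \<and>
     (\<forall>x\<in>\<Omega>. \<exists>y. is_derivative_at p \<Omega> F x y) \<and>
     submanifold (derivative_image p \<Omega> F) \<and>
     C1_on_submanifold (derivative_image p \<Omega> F) G \<and>
     (\<forall>x y. x \<in> \<Omega> \<and> is_derivative_at p \<Omega> F x y \<longrightarrow> p x y - F x = G y)"

text \<open>
  The largest open set on which a function is \<open>C\<^sup>1\<close>. It serves as \<open>\<Omega>\<close> for a function that is given
  by a formula on the whole space but is not differentiable everywhere, such as the area functional.
\<close>
definition C1_domain :: "('a::euclidean_space \<Rightarrow> real) \<Rightarrow> 'a set" where
  "C1_domain F = \<Union>{U. open U \<and> Ck_on 1 F U}"

text \<open>
  For a \<open>2 \<times> 3\<close> matrix \<open>x\<close>, the entry with upper index \<open>i\<close> and lower index \<open>j\<close> is \<open>x $ i $ j\<close>; for a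
  dual \<open>3 \<times> 2\<close> matrix \<open>y\<close>, the entry with upper index \<open>j\<close> and lower index \<open>i\<close> is \<open>y $ j $ i\<close>.
\<close>
definition matrix_pairing :: "real^3^2 \<Rightarrow> real^2^3 \<Rightarrow> real" where
  "matrix_pairing x y = (\<Sum>i\<in>UNIV. \<Sum>j\<in>UNIV. x $ i $ j * y $ j $ i)"

definition area_functional :: "real^3^2 \<Rightarrow> real" where
  "area_functional x = sqrt (
     (x$1$1 * x$2$2 - x$2$1 * x$1$2)\<^sup>2 +
     (x$1$1 * x$2$3 - x$2$1 * x$1$3)\<^sup>2 +
     (x$1$2 * x$2$3 - x$2$2 * x$1$3)\<^sup>2)"

definition dual_area_functional :: "real^2^3 \<Rightarrow> real" where
  "dual_area_functional y = sqrt (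
     (y$2$1 * y$3$2 - y$2$2 * y$3$1)\<^sup>2 +
     (y$1$1 * y$3$2 - y$1$2 * y$3$1)\<^sup>2 +
     (y$1$1 * y$2$2 - y$1$2 * y$2$1)\<^sup>2)"

end

theory Submission
  imports Defs
begin

text \<open>
  Let \<open>u\<close>, \<open>v\<close> be the rows of \<open>x\<close> and \<open>n = u \<times> v\<close>. Then \<open>F x = |n|\<close>, and for \<open>n \<noteq> 0\<close>, with
  \<open>s = n / |n|\<close>, the gradient of \<open>F\<close> has the rows \<open>v \<times> s\<close> and \<open>s \<times> u\<close>: the rows of \<open>x\<close> are
  exchanged up to sign and turned by a right angle in their plane. Hence the gradient has the same
  cross product \<open>n\<close>, and the gradient map is an involution of the matrices of rank 2. As \<open>F\<close> is
  homogeneous of degree 2, \<open>\<langle>x, F' x\<rangle> - F x = F x = F (F' x)\<close>. If \<open>n = 0\<close> and \<open>x \<noteq> 0\<close>, then \<open>F\<close> has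
  a corner at \<open>x\<close> along some line, and these points accumulate at \<open>0\<close>.
\<close>

section \<open>The area functional and its gradient in terms of cross products\<close>

unbundle cross3_syntax

definition row_cross :: "real^3^2 \<Rightarrow> real^3" where
  "row_cross x = x$1 \<times> x$2"

text \<open>The gradient for the Euclidean inner product on 2 by 3 matrices; the corresponding dual
  matrix is its transpose. As \<open>sgn 0 = 0\<close>, its value is 0 where the rows are linearly
  dependent.\<close>

definition area_gradient :: "real^3^2 \<Rightarrow> real^3^2" where
  "area_gradient x = vector [x$2 \<times> sgn (row_cross x), sgn (row_cross x) \<times> x$1]"

lemma area_functional_eq_norm: "area_functional x = norm (row_cross x)"
  by (simp add: area_functional_def row_cross_def norm_vec_def L2_set_def sum_3 cross_components
      power2_eq_square algebra_simps)

lemma dual_area_functional_eq: "dual_area_functional y = area_functional (transpose y)"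
  by (simp add: area_functional_def dual_area_functional_def transpose_def add.commute
      add.left_commute mult.commute)

lemma matrix_pairing_eq_inner: "matrix_pairing x y = x \<bullet> transpose y"
  by (simp add: matrix_pairing_def inner_vec_def transpose_def)

lemma bounded_linear_transpose: "bounded_linear (transpose :: real^'n^'m \<Rightarrow> real^'m^'n)"
  by (intro linear_conv_bounded_linear[THEN iffD1] linearI)
    (simp_all add: transpose_def vec_eq_iff)

lemma has_derivative_cross:
  assumes "(f has_derivative f') (at x within S)" "(g has_derivative g') (at x within S)"
  shows "((\<lambda>x. f x \<times> g x) has_derivative (\<lambda>h. f x \<times> g' h + f' h \<times> g x)) (at x within S)"
  using bounded_bilinear.FDERIV[OF _ assms, of "(\<times>)"] bilinear_cross
  by (simp add: bilinear_conv_bounded_bilinear)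

lemma continuous_on_row_cross: "continuous_on S row_cross"
  unfolding row_cross_def by (intro continuous_on_cross continuous_intros)

lemma row_cross_has_derivative:
  "(row_cross has_derivative (\<lambda>h. x$1 \<times> h$2 + h$1 \<times> x$2)) (at x)"
  unfolding row_cross_def
  by (intro has_derivative_cross bounded_linear_imp_has_derivative bounded_linear_vec_nth)

text \<open>Chain rule: the derivative of \<open>norm\<close> at \<open>n\<close> is the inner
  product with \<open>sgn n\<close>. Cyclic invariance of the triple product then moves each row of
  \<open>h\<close> to the front.\<close>

lemma area_functional_has_derivative:
  assumes "row_cross x \<noteq> 0"
  shows "(area_functional has_derivative (\<lambda>h. h \<bullet> area_gradient x)) (at x)"
proof -
  let ?s = "sgn (row_cross x)"
  have "((norm \<circ> row_cross) has_derivative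
      ((\<lambda>h. h \<bullet> ?s) \<circ> (\<lambda>h. x$1 \<times> h$2 + h$1 \<times> x$2))) (at x)"
    by (rule diff_chain_at[OF row_cross_has_derivative has_derivative_norm[OF assms]])
  moreover have "(x$1 \<times> h$2) \<bullet> ?s = h$2 \<bullet> (?s \<times> x$1)" "(h$1 \<times> x$2) \<bullet> ?s = h$1 \<bullet> (x$2 \<times> ?s)" for h :: "real^3^2"
    by (metis cross_triple inner_commute)+
  then have "(x$1 \<times> h$2 + h$1 \<times> x$2) \<bullet> ?s = h \<bullet> area_gradient x" for h
    by (simp add: area_gradient_def inner_vec_def[where 'b=2] sum_2 inner_add_left)
  ultimately show ?thesis
    by (simp add: o_def area_functional_eq_norm[abs_def])
qed

lemma row_cross_area_gradient:
  assumes "row_cross x \<noteq> 0"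
  shows "row_cross (area_gradient x) = row_cross x"
proof -
  let ?n = "row_cross x"
  \<comment> \<open>Expanding the double cross product leaves two determinants: one has a repeated
    entry \<open>?n\<close> and vanishes, the other is
    \<open>?n \<bullet> (x$1 \<times> x$2)\<close>. Normalising both factors \<open>?n\<close> later
    cancels \<open>?n \<bullet> ?n\<close>.\<close>
  have "(x$2 \<times> ?n) \<times> (?n \<times> x$1) = (?n \<bullet> ?n) *\<^sub>R ?n"
    unfolding cross_cross_det dot_cross_det[symmetric]
    by (metis cross_triple cross_refl diff_zero dot_cross_self(2) inner_commute row_cross_def
        scale_zero_left)
  moreover have "row_cross (area_gradient x) = (x$2 \<times> sgn ?n) \<times> (sgn ?n \<times> x$1)"
    by (simp add: row_cross_def area_gradient_def)
  ultimately show ?thesis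
    using assms
    by (simp add: sgn_div_norm cross_mult_left cross_mult_right power2_norm_eq_inner[symmetric]
        power2_eq_square) (simp add: mult.assoc[symmetric])
qed

text \<open>By \<open>row_cross_area_gradient\<close> both applications use the same unit normal
  \<open>?s\<close>. It is orthogonal to both rows, so the double products with it give the rows
  back.\<close>

lemma area_gradient_involution:
  assumes "row_cross x \<noteq> 0"
  shows "area_gradient (area_gradient x) = x"
proof -
  let ?s = "sgn (row_cross x)"
  have s: "?s \<bullet> ?s = 1" "?s \<bullet> x$1 = 0" "?s \<bullet> x$2 = 0"
    using assms by (simp_all add: norm_sgn power2_norm_eq_inner[symmetric])
      (simp_all add: sgn_div_norm row_cross_def dot_cross_self inner_commute)
  have "(?s \<times> x$1) \<times> ?s = x$1"
    using s by (subst cross_skew) (simp add: Lagrange)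
  moreover have "?s \<times> (x$2 \<times> ?s) = x$2"
    using s by (simp add: Lagrange)
  moreover have "area_gradient (area_gradient x)
      = vector [area_gradient x $ 2 \<times> ?s, ?s \<times> area_gradient x $ 1]"
    using row_cross_area_gradient[OF assms] by (simp only: area_gradient_def[of "area_gradient x"])
  ultimately show ?thesis
    by (simp add: vec_eq_iff[where 'b=2] forall_2 area_gradient_def[of x])
qed

text \<open>Euler's identity for the homogeneous function \<^term>\<open>area_functional\<close> of degree 2.\<close>
lemma inner_area_gradient: "x \<bullet> area_gradient x = 2 * area_functional x"
proof -
  let ?n = "row_cross x"
  have "x$1 \<bullet> (x$2 \<times> sgn ?n) = ?n \<bullet> sgn ?n" "x$2 \<bullet> (sgn ?n \<times> x$1) = ?n \<bullet> sgn ?n"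
    by (metis cross_triple inner_commute row_cross_def)+
  moreover have "?n \<bullet> sgn ?n = norm ?n"
    by (cases "?n = 0") (simp_all add: sgn_div_norm power2_norm_eq_inner[symmetric] power2_eq_square)
  ultimately show ?thesis
    by (simp add: inner_vec_def[where 'b=2] sum_2 area_gradient_def area_functional_eq_norm)
qed

section \<open>Rank 2 as nonvanishing of the cross product of the rows\<close>

lemma rank_eq_2_iff: "rank x = 2 \<longleftrightarrow> row_cross x \<noteq> 0" for x :: "real^3^2"
proof -
  have "rank x = 2 \<longleftrightarrow> inj ((*v) (transpose x))"
    using full_rank_injective[of "transpose x"] by (simp add: rank_transpose)
  also have "\<dots> \<longleftrightarrow> (\<forall>w. transpose x *v w = 0 \<longrightarrow> w = 0)"
    by (simp add: linear_injective_0)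
  also have "\<dots> \<longleftrightarrow> (\<forall>a b. a *\<^sub>R x$1 + b *\<^sub>R x$2 = 0 \<longrightarrow> a = 0 \<and> b = 0)" (is "?L \<longleftrightarrow> ?R")
  proof -
    have "transpose x *v w = w$1 *\<^sub>R x$1 + w$2 *\<^sub>R x$2" for w
      by (simp add: matrix_vector_mult_def transpose_def sum_2 vec_eq_iff mult.commute)
    moreover have "\<exists>w::real^2. w$1 = a \<and> w$2 = b" for a b
      by (rule exI[of _ "vector [a, b]"]) simp
    ultimately show ?thesis
      by (simp add: vec_eq_iff[of _ "0::real^2"] forall_2) metis
  qed
  also have "\<dots> \<longleftrightarrow> row_cross x \<noteq> 0"
  proof
    assume R: ?R
    show "row_cross x \<noteq> 0"
    proof
      assume "row_cross x = 0"
      then have "collinear {0, x$1, x$2}"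
        by (simp add: row_cross_def cross_eq_0)
      then consider "x$1 = 0" | "x$2 = 0" | c where "x$2 = c *\<^sub>R x$1"
        by (auto simp: collinear_lemma)
      then show False
      proof cases
        case 1 then show False using R[rule_format, of 1 0] by simp
      next
        case 2 then show False using R[rule_format, of 0 1] by simp
      next
        case 3 then show False using R[rule_format, of "-c" 1] by simp
      qed
    qed
  next
    assume n: "row_cross x \<noteq> 0"
    show ?R
    proof (intro allI impI)
      fix a b assume eq: "a *\<^sub>R x$1 + b *\<^sub>R x$2 = 0"
      \<comment> \<open>Crossing a linear relation with one row removes that row and isolates the
        coefficient of the other.\<close>
      have "x$1 \<times> (a *\<^sub>R x$1 + b *\<^sub>R x$2) = b *\<^sub>R row_cross x"
        "(a *\<^sub>R x$1 + b *\<^sub>R x$2) \<times> x$2 = a *\<^sub>R row_cross x"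
        by (simp_all add: cross_add_right cross_add_left cross_mult_right cross_mult_left
            row_cross_def)
      then show "a = 0 \<and> b = 0"
        unfolding eq using n by simp
    qed
  qed
  finally show ?thesis .
qed

section \<open>The largest open set on which the area functional is C1\<close>

lemma open_row_cross_nonzero: "open {x. row_cross x \<noteq> 0}"
  using continuous_on_row_cross by (intro open_Collect_neq continuous_on_const) auto

lemma continuous_on_area_gradient: "continuous_on {x. row_cross x \<noteq> 0} area_gradient"
proof -
  have "continuous_on {x. row_cross x \<noteq> 0} (\<lambda>x. area_gradient x $ i)" for i
    using exhaust_2[of i]
    by (elim disjE; simp add: area_gradient_def)
      (auto intro!: continuous_on_cross continuous_intros continuous_on_row_cross)
  then show ?thesis
    using continuous_on_vec_lambda[of "{x. row_cross x \<noteq> 0}" "\<lambda>i x. area_gradient x $ i"] by simp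
qed

text \<open>\<open>Ck_on\<close> refers to the chosen value \<open>frechet_derivative\<close>;
  uniqueness of derivatives lets an explicit formula replace it.\<close>

lemma Ck_on_1_has_derivative:
  assumes "\<And>x. x \<in> U \<Longrightarrow> (f has_derivative f' x) (at x)"
    and "\<And>v. continuous_on U (\<lambda>x. f' x v)"
  shows "Ck_on 1 f U"
proof -
  have "frechet_derivative f (at x) = f' x" if "x \<in> U" for x
    using assms(1)[OF that] by (metis frechet_derivative_at)
  then have "continuous_on U (\<lambda>x. frechet_derivative f (at x) v)" for v
    using assms(2)[of v] by (simp cong: continuous_on_cong)
  then show ?thesis
    using assms(1) by (auto simp: differentiable_def)
qed

lemma Ck_on_1_area_functional: "Ck_on 1 area_functional {x. row_cross x \<noteq> 0}"
  by (rule Ck_on_1_has_derivative[where f' = "\<lambda>x h. h \<bullet> area_gradient x"])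
    (auto intro!: area_functional_has_derivative continuous_intros continuous_on_area_gradient)

text \<open>\<open>row_cross\<close> is quadratic. Along this line its constant and its quadratic
  term in \<open>t\<close> vanish, and the norm of the remaining linear term is a multiple of
  \<open>\<bar>t\<bar>\<close>.\<close>

lemma area_functional_on_line:
  assumes "area_functional x = 0" "area_functional z = 0"
  shows "area_functional (x + t *\<^sub>R z) = \<bar>t\<bar> * area_functional (x + z)"
proof -
  have "row_cross x = 0" "row_cross z = 0"
    using assms by (simp_all add: area_functional_eq_norm)
  then have "row_cross (x + t *\<^sub>R z) = t *\<^sub>R row_cross (x + z)"
    by (simp add: row_cross_def cross_add_left cross_add_right cross_mult_left cross_mult_right
        scaleR_right_distrib)
  then show ?thesis
    by (simp add: area_functional_eq_norm)
qed

text \<open>A matrix with a zero row has zero cross product. The other row of \<open>z\<close> is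
  chosen not parallel to a nonzero row of \<open>x\<close>, which gives \<open>x + z\<close>
  independent rows.\<close>

lemma exists_nonzero_direction:
  assumes "row_cross x = 0" "x \<noteq> 0"
  obtains z where "row_cross z = 0" "row_cross (x + z) \<noteq> 0"
proof (cases "x$1 = 0")
  case False
  then obtain e where e: "x$1 \<times> e \<noteq> 0"
    using cross_basis_nonzero by blast
  show ?thesis
    by (rule that[of "vector [0, e]"])
      (use assms e in \<open>simp_all add: row_cross_def cross_add_right\<close>)
next
  case True
  then have "x$2 \<noteq> 0"
    using assms by (auto simp: vec_eq_iff[of x] forall_2)
  then obtain e where e: "x$2 \<times> e \<noteq> 0"
    using cross_basis_nonzero by blast
  show ?thesis
    by (rule that[of "vector [e, 0]"])
      (use True e cross_skew[of e "x$2"] in \<open>simp_all add: row_cross_def\<close>)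
qed

text \<open>The difference quotient is \<open>c\<close> on the right of 0 and \<open>- c\<close> on
  the left.\<close>

lemma abs_not_differentiable_at_0:
  assumes "((\<lambda>t::real. \<bar>t\<bar> * c) has_real_derivative D) (at 0)"
  shows "c = 0"
proof -
  have lim: "((\<lambda>h. \<bar>h\<bar> * c / h) \<longlongrightarrow> D) (at 0)"
    using assms by (simp add: has_field_derivative_iff)
  have "((\<lambda>h. \<bar>h\<bar> * c / h) \<longlongrightarrow> c) (at_right 0)"
    by (rule tendsto_eventually) (auto simp: eventually_at_filter)
  moreover have "((\<lambda>h. \<bar>h\<bar> * c / h) \<longlongrightarrow> - c) (at_left 0)"
    by (rule tendsto_eventually) (auto simp: eventually_at_filter)
  ultimately have "D = c" "D = - c"
    using lim tendsto_unique[OF trivial_limit_at_right_real]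
      tendsto_unique[OF trivial_limit_at_left_real]
    by (auto simp: filterlim_at_split)
  then show ?thesis by simp
qed

lemma area_functional_not_differentiable:
  assumes "row_cross x = 0" "x \<noteq> 0"
  shows "\<not> area_functional differentiable (at x)"
proof
  assume "area_functional differentiable (at x)"
  then obtain D where D: "(area_functional has_derivative D) (at x)"
    by (auto simp: differentiable_def)
  obtain z where z: "row_cross z = 0" "row_cross (x + z) \<noteq> 0"
    using exists_nonzero_direction[OF assms] .
  have "((\<lambda>t. x + t *\<^sub>R z) has_derivative (\<lambda>t. t *\<^sub>R z)) (at 0)"
    by (auto intro!: derivative_eq_intros)
  then have "((area_functional \<circ> (\<lambda>t. x + t *\<^sub>R z)) has_derivative (D \<circ> (\<lambda>t. t *\<^sub>R z))) (at 0)"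
    using D by (intro diff_chain_at) simp_all
  moreover have "area_functional \<circ> (\<lambda>t. x + t *\<^sub>R z) = (\<lambda>t. \<bar>t\<bar> * area_functional (x + z))"
    using area_functional_on_line[of x z] assms z
    by (simp add: o_def area_functional_eq_norm[of x] area_functional_eq_norm[of z])
  ultimately have "(\<lambda>t. \<bar>t\<bar> * area_functional (x + z)) differentiable (at 0)"
    by (auto simp: differentiable_def)
  then have "area_functional (x + z) = 0"
    using abs_not_differentiable_at_0 by (auto simp: real_differentiable_def)
  then show False
    using z by (simp add: area_functional_eq_norm)
qed

lemma C1_domain_area_functional: "C1_domain area_functional = {x. row_cross x \<noteq> 0}"
proof (intro equalityI subsetI)
  fix x assume "x \<in> {x. row_cross x \<noteq> 0}"
  then show "x \<in> C1_domain area_functional"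
    unfolding C1_domain_def using open_row_cross_nonzero Ck_on_1_area_functional by blast
next
  fix x assume "x \<in> C1_domain area_functional"
  then obtain U where U: "open U" "x \<in> U" and diff: "\<forall>x\<in>U. area_functional differentiable (at x)"
    by (auto simp: C1_domain_def)
  \<comment> \<open>The origin needs its own argument, because the quadratic growth of the
    functional makes it differentiable there. The ray through a rank 1 matrix \<open>z\<close>
    enters every neighbourhood of 0 and consists of corner points for \<open>t > 0\<close>.\<close>
  have "x \<noteq> 0"
  proof
    assume "x = 0"
    define z :: "real^3^2" where "z = vector [axis 1 1, 0]"
    have "z \<noteq> 0"
      by (simp add: z_def vec_eq_iff[of _ "0::real^3^2"] forall_2 axis_eq_0_iff)
    have "((\<lambda>t. t *\<^sub>R z) \<longlongrightarrow> 0 *\<^sub>R z) (at_right 0)"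
      by (intro tendsto_intros)
    then have "\<forall>\<^sub>F t in at_right 0. t *\<^sub>R z \<in> U"
      using U \<open>x = 0\<close> by (auto intro: topological_tendstoD)
    moreover have "\<forall>\<^sub>F t::real in at_right 0. t > 0"
      by (simp add: eventually_at_right_less)
    ultimately have "\<forall>\<^sub>F t in at_right 0. t > 0 \<and> t *\<^sub>R z \<in> U"
      by eventually_elim simp
    then obtain t where t: "t > 0" "t *\<^sub>R z \<in> U"
      by (metis (mono_tags, lifting) eventually_happens trivial_limit_at_right_real)
    have "row_cross (t *\<^sub>R z) = 0" "t *\<^sub>R z \<noteq> 0"
      using t \<open>z \<noteq> 0\<close> by (simp_all add: row_cross_def z_def)
    then show False
      using area_functional_not_differentiable diff t by blast
  qed
  then show "x \<in> {x. row_cross x \<noteq> 0}"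
    using area_functional_not_differentiable diff U by blast
qed

section \<open>The derivative with respect to the pairing, and its image\<close>

lemma is_derivative_at_area_functional_iff:
  assumes "row_cross x \<noteq> 0"
  shows "is_derivative_at matrix_pairing {x. row_cross x \<noteq> 0} area_functional x y
    \<longleftrightarrow> transpose y = area_gradient x"
proof -
  have at: "at x within {x. row_cross x \<noteq> 0} = at x"
    using assms open_row_cross_nonzero by (intro at_within_open) auto
  have "transpose y = area_gradient x"
    if "(area_functional has_derivative (\<lambda>h. h \<bullet> transpose y)) (at x)"
    using has_derivative_unique[OF that area_functional_has_derivative[OF assms]]
    by (simp add: fun_eq_iff vector_eq_ldot)
  then show ?thesis
    using area_functional_has_derivative[OF assms]
    by (auto simp: is_derivative_at_def at matrix_pairing_eq_inner)
qed

lemma transpose_image_row_cross_nonzero: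
  "transpose ` {x. row_cross x \<noteq> 0} = {y. row_cross (transpose y) \<noteq> 0}"
  by (force simp: image_iff intro: transpose_transpose[symmetric])

text \<open>Every matrix with independent rows is the gradient at its own gradient, by the
  involution; conversely, the gradient preserves \<open>row_cross\<close>, hence its
  nonvanishing.\<close>

lemma derivative_image_area_functional:
  "derivative_image matrix_pairing {x. row_cross x \<noteq> 0} area_functional
    = transpose ` {x. row_cross x \<noteq> 0}"
proof -
  have "(\<exists>x. row_cross x \<noteq> 0 \<and> transpose y = area_gradient x) \<longleftrightarrow> row_cross (transpose y) \<noteq> 0"
    for y
    by (metis area_gradient_involution row_cross_area_gradient)
  then show ?thesis
    unfolding transpose_image_row_cross_nonzero
    by (auto simp: derivative_image_def is_derivative_at_area_functional_iff)
qed

lemma continuous_on_row_cross_transpose: "continuous_on S (\<lambda>y. row_cross (transpose y))"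
  by (rule continuous_on_compose2[OF continuous_on_row_cross
        linear_continuous_on[OF bounded_linear_transpose] subset_UNIV])

lemma open_row_cross_transpose_nonzero: "open {y. row_cross (transpose y) \<noteq> 0}"
  by (intro open_Collect_neq continuous_on_const continuous_on_row_cross_transpose)

section \<open>Submanifold structure, duality and the Legendre identity\<close>

lemma Ck_on_const: "Ck_on k (\<lambda>x. c) U"
  by (induction k arbitrary: c) (simp_all add: frechet_derivative_const)

lemma Ck_on_ident: "Ck_on k (\<lambda>x. x) U"
  by (cases k) (simp_all add: frechet_derivative_id Ck_on_const)

lemma open_imp_submanifold:
  fixes S :: "'a::euclidean_space set"
  assumes "open S"
  shows "submanifold S"
proof -
  have "smooth_diffeo S S (\<lambda>x. x) (\<lambda>x. x)"
    using assms by (auto simp: smooth_diffeo_def homeomorphism_def Ck_on_ident)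
  moreover have "subspace (UNIV :: 'a set)" by simp
  ultimately have "\<exists>U V \<phi> \<psi> L. p \<in> U \<and> smooth_diffeo U V \<phi> \<psi> \<and>
      subspace L \<and> dim L = DIM('a) \<and> \<phi> ` (U \<inter> S) = V \<inter> L" if "p \<in> S" for p
    \<comment> \<open>The identity is a global slice chart, with the whole space as the linear
      subspace.\<close>
    using that by (intro exI[of _ S] exI[of _ "\<lambda>x. x"] exI[of _ UNIV]) simp
  then show ?thesis
    unfolding submanifold_def by blast
qed

lemma Ck_on_1_dual_area_functional:
  "Ck_on 1 dual_area_functional {y. row_cross (transpose y) \<noteq> 0}"
proof (rule Ck_on_1_has_derivative)
  fix y :: "real^2^3" assume "y \<in> {y. row_cross (transpose y) \<noteq> 0}"
  then have "((area_functional \<circ> transpose) has_derivative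
      ((\<lambda>h. h \<bullet> area_gradient (transpose y)) \<circ> transpose)) (at y)"
    by (intro diff_chain_at bounded_linear_imp_has_derivative bounded_linear_transpose
        area_functional_has_derivative) simp
  then show "(dual_area_functional has_derivative
      (\<lambda>h. transpose h \<bullet> area_gradient (transpose y))) (at y)"
    by (simp add: o_def dual_area_functional_eq[abs_def])
next
  fix v :: "real^2^3"
  show "continuous_on {y. row_cross (transpose y) \<noteq> 0}
      (\<lambda>y. transpose v \<bullet> area_gradient (transpose y))"
    by (intro continuous_intros continuous_on_compose2[OF continuous_on_area_gradient
          linear_continuous_on[OF bounded_linear_transpose]]) auto
qed

lemma duality_pairing_matrix_pairing: "duality_pairing matrix_pairing"
proof -
  have lin: "linear (transpose :: real^2^3 \<Rightarrow> real^3^2)"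
    by (rule bounded_linear.linear[OF bounded_linear_transpose])
  have "bilinear matrix_pairing"
    by (auto simp: bilinear_def matrix_pairing_eq_inner inner_left_distrib inner_right_distrib
        linear_add[OF lin] linear_scale[OF lin] intro!: linearI)
  moreover have "x = 0" if "\<forall>y. matrix_pairing x y = 0" for x
    using that[rule_format, of "transpose x"] by (simp add: matrix_pairing_eq_inner)
  moreover have "y = 0" if "\<forall>x. matrix_pairing x y = 0" for y
  proof -
    have "transpose y = 0"
      using that[rule_format, of "transpose y"] by (simp add: matrix_pairing_eq_inner)
    then show ?thesis
      by (simp add: transpose_def vec_eq_iff)
  qed
  ultimately show ?thesis
    by (auto simp: duality_pairing_def)
qed

lemma matrix_pairing_minus_area_functional:
  assumes "row_cross x \<noteq> 0" "transpose y = area_gradient x"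
  shows "matrix_pairing x y - area_functional x = dual_area_functional y"
  using assms inner_area_gradient[of x] row_cross_area_gradient[of x]
  by (simp add: matrix_pairing_eq_inner dual_area_functional_eq area_functional_eq_norm)

lemma is_legendre_transform_area_functional:
  "is_legendre_transform matrix_pairing {x. row_cross x \<noteq> 0} area_functional dual_area_functional"
proof -
  let ?S = "{x. row_cross x \<noteq> 0}" and ?T = "{y. row_cross (transpose y) \<noteq> 0}"
  have "C1_on_submanifold ?T dual_area_functional"
    unfolding C1_on_submanifold_def
    using Ck_on_1_dual_area_functional open_row_cross_transpose_nonzero by blast
  moreover have "\<exists>y. is_derivative_at matrix_pairing ?S area_functional x y" if "x \<in> ?S" for x
    using that by (intro exI[of _ "transpose (area_gradient x)"])
      (simp add: is_derivative_at_area_functional_iff)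
  moreover have "matrix_pairing x y - area_functional x = dual_area_functional y"
    if "x \<in> ?S" "is_derivative_at matrix_pairing ?S area_functional x y" for x y
    using that by (simp add: is_derivative_at_area_functional_iff matrix_pairing_minus_area_functional)
  ultimately show ?thesis
    unfolding is_legendre_transform_def derivative_image_area_functional
      transpose_image_row_cross_nonzero
    by (blast intro: duality_pairing_matrix_pairing open_imp_submanifold open_row_cross_nonzero
        open_row_cross_transpose_nonzero)
qed

section \<open>Uniqueness of the continuous Legendre transform\<close>

text \<open>On the line through \<open>y\<close> in the direction of \<open>(e\<^sub>1, e\<^sub>2)\<close> one of the minors is a monic quadratic.\<close>
lemma dense_row_cross_transpose_nonzero: "closure {y. row_cross (transpose y) \<noteq> 0} = UNIV"
proof -
  have "y \<in> closure {y. row_cross (transpose y) \<noteq> 0}" for y :: "real^2^3"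
  proof -
    define z :: "real^2^3" where "z = transpose (vector [axis 1 1, axis 2 1])"
    define p :: "real poly" where
      "p = [: y$1$1 * y$2$2 - y$2$1 * y$1$2, y$1$1 + y$2$2, 1 :]"
    have p: "row_cross (transpose (y + t *\<^sub>R z)) $ 3 = poly p t" for t
      by (simp add: row_cross_def cross_components transpose_def z_def p_def axis_def
          algebra_simps)
    have "finite {t. poly p t = 0}"
      by (rule poly_roots_finite) (simp add: p_def)
    \<comment> \<open>A finite set of roots does not accumulate at 0, so all small nonzero
      \<open>t\<close> give a nonzero minor.\<close>
    then have "\<forall>\<^sub>F t in at 0. t \<notin> {t. poly p t = 0}"
      using islimpt_finite islimpt_iff_eventually by blast
    then have "\<forall>\<^sub>F t in at 0. row_cross (transpose (y + t *\<^sub>R z)) \<noteq> 0"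
      by eventually_elim (simp add: p[symmetric] vec_eq_iff[of _ "0 :: real^3"] forall_3)
    then have ev: "\<forall>\<^sub>F t in at 0. y + t *\<^sub>R z \<in> closure {y. row_cross (transpose y) \<noteq> 0}"
      by eventually_elim (simp add: closure_subset[THEN subsetD])
    have "((\<lambda>t. y + t *\<^sub>R z) \<longlongrightarrow> y + 0 *\<^sub>R z) (at 0)"
      by (intro tendsto_intros)
    then show ?thesis
      using Lim_in_closed_set[OF closed_closure ev] by simp
  qed
  then show ?thesis by auto
qed

text \<open>The Legendre identity fixes \<open>G\<close> on the derivative image; this set is dense,
  so continuity fixes \<open>G\<close> everywhere.\<close>

lemma legendre_transform_area_functional_unique:
  assumes "continuous_on UNIV G"
    and "is_legendre_transform matrix_pairing {x. row_cross x \<noteq> 0} area_functional G"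
  shows "G = dual_area_functional"
proof -
  have agree: "G y - dual_area_functional y = 0" if "row_cross (transpose y) \<noteq> 0" for y
  proof -
    \<comment> \<open>The involution supplies the point whose derivative is
      \<open>y\<close>.\<close>
    let ?x = "area_gradient (transpose y)"
    have x: "row_cross ?x \<noteq> 0" "transpose y = area_gradient ?x"
      using that by (simp_all add: row_cross_area_gradient area_gradient_involution)
    have "matrix_pairing ?x y - area_functional ?x = G y"
      using assms(2) x unfolding is_legendre_transform_def
      by (simp add: is_derivative_at_area_functional_iff)
    then show ?thesis
      using matrix_pairing_minus_area_functional[OF x] by simp
  qed
  have "continuous_on UNIV dual_area_functional"
    unfolding dual_area_functional_eq[abs_def] area_functional_eq_norm
    by (intro continuous_intros continuous_on_row_cross_transpose)
  then have "continuous_on UNIV (\<lambda>y. G y - dual_area_functional y)"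
    using assms(1) by (intro continuous_intros)
  then have "continuous_on (closure {y. row_cross (transpose y) \<noteq> 0})
      (\<lambda>y. G y - dual_area_functional y)"
    by (simp only: dense_row_cross_transpose_nonzero)
  then have "G y - dual_area_functional y = 0" for y
    by (rule continuous_constant_on_closure)
      (simp_all add: agree dense_row_cross_transpose_nonzero)
  then show ?thesis by auto
qed

text \<open>The area formula is not differentiable at nonzero matrices of rank below 2, so its C1
  domain serves as the set on which the transform is taken. Continuity of \<open>G\<close> extends
  the uniqueness beyond the derivative image, which makes self-duality an equality of functions on
  the whole space.\<close>

theorem mainTheorem4:
  "C1_domain area_functional = {x. rank x = 2} \<and>
   derivative_image matrix_pairing (C1_domain area_functional) area_functional
     = transpose ` C1_domain area_functional \<and>
   is_legendre_transform matrix_pairing (C1_domain area_functional) area_functional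
     dual_area_functional \<and>
   (\<forall>G. continuous_on UNIV G \<and>
        is_legendre_transform matrix_pairing (C1_domain area_functional) area_functional G
        \<longrightarrow> G = dual_area_functional) \<and>
   (\<forall>y. dual_area_functional y = area_functional (transpose y))"
  unfolding C1_domain_area_functional rank_eq_2_iff
  using derivative_image_area_functional is_legendre_transform_area_functional
    legendre_transform_area_functional_unique dual_area_functional_eq
  by blast

end
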